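(* Consider the decision-dependent distributionally robust problem $$\min_{x\in\mathcal X}\; c^\top x+x^\top C x+\max_{p\in\mathcal P(x)}\ \sum_{\omega=1}^N p_\omega\, h(x,\xi_\omega).\qquad (\mathrm{DRO})$$ Then (DRO) can be reformulated as the nonconvex mixed-integer nonlinear program $$\begin{aligned}\min_{x,\lambda,y_1,\dots,y_N,\gamma,\mu}\ & c^\top x+x^\top C x+\lambda^\top\vartheta(x)+\sum_{\omega\in[N]}\big(\gamma_\omega\overline p_\omega-\mu_\omega\underline p_\omega\big)\\ \text{s.t.}\quad & x\in\mathcal X,\ \lambda\in\mathbb R^s,\ \lambda\ge 0,\\ & \gamma_\omega-\mu_\omega\ge\psi_0(x,y_\omega,\xi_\omega)-\lambda^\top g(\xi_\omega),\quad\omega\in[N],\\ & y_\omega\in\mathcal Y(x,\xi_\omega),\quad\omega\in[N],\\ & \gamma,\mu\in\mathbb R^N,\ \gamma\ge 0,\ \mu\ge 0.\end{aligned}$$ That is, the two problems have the same optimal value, and $x^*\in\mathcal X$ is optimal for (DRO) if and only if $x^*$ is the $x$-component of an optimal solution of the second problem.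
   Context: Notation: $[n]=\{1,\dots,n\}$; vector inequalities are componentwise. Setting. $\mathcal X=\{x\in\mathbb Z^{n_1}\times\mathbb R^{n_x-n_1}: Ax\ge d,\ x\ge 0\}$ is nonempty and compact, $n_1\ge 0$. The random vector $\xi$ has finite, decision-independent support $\{\xi_\omega\}_{\omega=1}^N$. The recourse function is $$h(x,\xi_\omega)=\min_{y\in\mathcal Y(x,\xi_\omega)}\psi_0(x,y,\xi_\omega),\qquad \psi_0(x,y,\xi_\omega)=q_\omega^\top y+x^\top L_\omega y,$$ $$\mathcal Y(x,\xi_\omega)=\{y\in\mathbb R^{n_y}: D_\omega y\ge B_\omega x+b_\omega,\ y\ge 0\},$$ with data $q_\omega,L_\omega,D_\omega,B_\omega,b_\omega$ of appropriate dimensions. Ambiguity set. For $x\in\mathcal X$, $$\mathcal P(x)=\Big\{p\in\mathbb R^N,\ p\ge 0:\ \underline p_\omega\le p_\omega\le\overline p_\omega\ (\omega\in[N]),\ \sum_{\omega\in[N]}p_\omega g^i(\xi_\omega)\le\vartheta^i(x)\ (i\in[s])\Big\},$$ where $0\le\underline p_\omega\le\overline p_\omega$ are bounds on the probabilities, $g^i$ are real functions on the support, $\vartheta^i:\mathcal X\to\mathbb R$, and $g=(g^1,\dots,g^s)^\top$, $\vartheta(x)=(\vartheta^1(x),\dots,\vartheta^s(x))^\top$. To force $p$ to be a probability vector, $g^1\equiv 1,\vartheta^1\equiv 1,g^2\equiv -1,\vartheta^2\equiv -1$. Standing assumptions. $\mathcal P(x)$ is nonempty for every $x\in\mathcal X$.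 For every $x\in\mathbb R^{n_x}$ and $\omega\in[N]$ the recourse problem has complete recourse (it is feasible, $\mathcal Y(x,\xi_\omega)\neq\emptyset$) and $\mathcal Y(x,\xi_\omega)$ is bounded. *)

theory Defs
  imports "HOL-Analysis.Analysis"
begin

text \<open>
  Index types: \<open>'n\<close> first-stage variables, \<open>'m\<close> recourse variables, \<open>'w\<close> scenarios,
  \<open>'s\<close> moment constraints, \<open>'k\<close> and \<open>'l\<close> rows of the two constraint systems.
  Inequalities between vectors are componentwise (\<open>less_eq_vec_def\<close>).
\<close>

text \<open>
  \<open>I\<close> is the set of integer coordinates; for \<open>\<int>^n1 \<times> \<real>^(nx - n1)\<close> it has \<open>n1\<close> elements.
\<close>

definition first_stage_set ::
    "'n set \<Rightarrow> real^'n^'k \<Rightarrow> real^'k \<Rightarrow> (real^'n::finite) set" where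
  "first_stage_set I A d = {x. (\<forall>j\<in>I. x $ j \<in> \<int>) \<and> A *v x \<ge> d \<and> x \<ge> 0}"

definition recourse_cost ::
    "('w \<Rightarrow> real^'m) \<Rightarrow> ('w \<Rightarrow> real^'m^'n) \<Rightarrow>
     real^'n::finite \<Rightarrow> real^'m::finite \<Rightarrow> 'w \<Rightarrow> real" where
  "recourse_cost q L x y \<omega> = q \<omega> \<bullet> y + x \<bullet> (L \<omega> *v y)"

definition recourse_set ::
    "('w \<Rightarrow> real^'m^'l) \<Rightarrow> ('w \<Rightarrow> real^'n^'l) \<Rightarrow> ('w \<Rightarrow> real^'l) \<Rightarrow>
     real^'n::finite \<Rightarrow> 'w \<Rightarrow> (real^'m::finite) set" where
  "recourse_set D B b x \<omega> = {y. D \<omega> *v y \<ge> B \<omega> *v x + b \<omega> \<and> y \<ge> 0}"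

text \<open>
  The minimum is written as a real infimum; it is attained whenever the recourse set is
  nonempty and bounded, see \<open>recourse_value_attained\<close> below.
\<close>

definition recourse_value ::
    "('x \<Rightarrow> 'y \<Rightarrow> 'w \<Rightarrow> real) \<Rightarrow> ('x \<Rightarrow> 'w \<Rightarrow> 'y set) \<Rightarrow> 'x \<Rightarrow> 'w \<Rightarrow> real" where
  "recourse_value \<psi> Y x \<omega> = (INF y\<in>Y x \<omega>. \<psi> x y \<omega>)"

definition ambiguity_set ::
    "real^'w \<Rightarrow> real^'w \<Rightarrow> ('r \<Rightarrow> real^'s) \<Rightarrow> ('w \<Rightarrow> 'r) \<Rightarrow>
     ('x \<Rightarrow> real^'s::finite) \<Rightarrow> 'x \<Rightarrow> (real^'w::finite) set" where
  "ambiguity_set pl pu g \<xi> \<theta> x =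
     {p. p \<ge> 0 \<and> (\<forall>\<omega>. pl $ \<omega> \<le> p $ \<omega> \<and> p $ \<omega> \<le> pu $ \<omega>) \<and>
         (\<forall>i. (\<Sum>\<omega>\<in>UNIV. p $ \<omega> * g (\<xi> \<omega>) $ i) \<le> \<theta> x $ i)}"

text \<open>
  The maximum over the ambiguity set is written as a real supremum; it is attained whenever
  the ambiguity set is nonempty, see \<open>worst_case_attained\<close> below.
\<close>

definition dro_objective ::
    "real^'n \<Rightarrow> real^'n^'n \<Rightarrow> (real^'n \<Rightarrow> 'w \<Rightarrow> real) \<Rightarrow> (real^'n \<Rightarrow> (real^'w) set) \<Rightarrow>
     real^'n::finite \<Rightarrow> real" where
  "dro_objective c C h P x =
     c \<bullet> x + x \<bullet> (C *v x) + (SUP p\<in>P x. \<Sum>\<omega>\<in>UNIV. p $ \<omega> * h x (\<omega>::'w::finite))"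

text \<open>Points of the reformulation are tuples \<open>(x, lam, y, \<gamma>, \<mu>)\<close>, where \<open>y \<omega>\<close> is the
  recourse decision for scenario \<open>\<omega>\<close>.\<close>

definition minlp_feasible ::
    "'x set \<Rightarrow> ('x \<Rightarrow> 'w \<Rightarrow> 'y set) \<Rightarrow> ('x \<Rightarrow> 'y \<Rightarrow> 'w \<Rightarrow> real) \<Rightarrow> ('r \<Rightarrow> real^'s) \<Rightarrow>
     ('w \<Rightarrow> 'r) \<Rightarrow>
     ('x \<times> (real^'s::finite) \<times> ('w \<Rightarrow> 'y) \<times> (real^'w) \<times> (real^'w::finite)) set" where
  "minlp_feasible X Y \<psi> g \<xi> =
     {(x, lam, y, \<gamma>, \<mu>).
        x \<in> X \<and> lam \<ge> 0 \<and>
        (\<forall>\<omega>. \<gamma> $ \<omega> - \<mu> $ \<omega> \<ge> \<psi> x (y \<omega>) \<omega> - lam \<bullet> g (\<xi> \<omega>)) \<and>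
        (\<forall>\<omega>. y \<omega> \<in> Y x \<omega>) \<and>
        \<gamma> \<ge> 0 \<and> \<mu> \<ge> 0}"

fun minlp_objective ::
    "real^'n \<Rightarrow> real^'n^'n \<Rightarrow> (real^'n \<Rightarrow> real^'s) \<Rightarrow> real^'w \<Rightarrow> real^'w \<Rightarrow>
     (real^'n::finite) \<times> (real^'s::finite) \<times> ('w \<Rightarrow> 'y) \<times> (real^'w) \<times> (real^'w::finite) \<Rightarrow>
     real" where
  "minlp_objective c C \<theta> pl pu (x, lam, y, \<gamma>, \<mu>) =
     c \<bullet> x + x \<bullet> (C *v x) + lam \<bullet> \<theta> x + (\<Sum>\<omega>\<in>UNIV. \<gamma> $ \<omega> * pu $ \<omega> - \<mu> $ \<omega> * pl $ \<omega>)"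

text \<open>An infimum in the extended reals, so that it is meaningful without attainment.\<close>

definition optimal_value :: "('a \<Rightarrow> real) \<Rightarrow> 'a set \<Rightarrow> ereal" where
  "optimal_value f S = (INF z\<in>S. ereal (f z))"

abbreviation optimal_solution :: "('a \<Rightarrow> real) \<Rightarrow> 'a set \<Rightarrow> 'a \<Rightarrow> bool" where
  "optimal_solution f S z \<equiv> is_arg_min f (\<lambda>z. z \<in> S) z"

lemma recourse_value_attained:
  fixes q :: "'w \<Rightarrow> real^'m"
  assumes "recourse_set D B b x \<omega> \<noteq> {}" and "bounded (recourse_set D B b x \<omega>)"
  shows "\<exists>y\<in>recourse_set D B b x \<omega>.
           recourse_value (recourse_cost q L) (recourse_set D B b) x \<omega> = recourse_cost q L x y \<omega> \<and>
           (\<forall>z\<in>recourse_set D B b x \<omega>. recourse_cost q L x y \<omega> \<le> recourse_cost q L x z \<omega>)"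
proof -
  let ?Y = "recourse_set D B b x \<omega>" and ?f = "\<lambda>y. recourse_cost q L x y \<omega>"
  have "closed ?Y"
    unfolding recourse_set_def less_eq_vec_def
    by (simp add: closed_Collect_conj closed_Collect_all closed_Collect_le
        continuous_on_component matrix_vector_mult_linear_continuous_on)
  with assms have "compact ?Y" by (simp add: compact_eq_bounded_closed)
  moreover have "continuous_on ?Y ?f"
    unfolding recourse_cost_def
    by (intro continuous_on_add continuous_on_inner continuous_on_const continuous_on_id
        matrix_vector_mult_linear_continuous_on)
  ultimately obtain y where y: "y \<in> ?Y" "\<forall>z\<in>?Y. ?f y \<le> ?f z"
    using continuous_attains_inf[OF _ assms(1), of ?f] by blast
  then have "(INF y\<in>?Y. ?f y) = ?f y" by (intro cInf_eq_minimum) auto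
  with y show ?thesis by (auto simp: recourse_value_def)
qed

lemma worst_case_attained:
  fixes f :: "'w::finite \<Rightarrow> real"
  assumes "ambiguity_set pl pu g \<xi> \<theta> x \<noteq> {}"
  shows "\<exists>p\<in>ambiguity_set pl pu g \<xi> \<theta> x.
           (SUP p\<in>ambiguity_set pl pu g \<xi> \<theta> x. \<Sum>\<omega>\<in>UNIV. p $ \<omega> * f \<omega>) =
             (\<Sum>\<omega>\<in>UNIV. p $ \<omega> * f \<omega>) \<and>
           (\<forall>r\<in>ambiguity_set pl pu g \<xi> \<theta> x.
              (\<Sum>\<omega>\<in>UNIV. r $ \<omega> * f \<omega>) \<le> (\<Sum>\<omega>\<in>UNIV. p $ \<omega> * f \<omega>))"
proof -
  let ?P = "ambiguity_set pl pu g \<xi> \<theta> x" and ?f = "\<lambda>p::real^'w. \<Sum>\<omega>\<in>UNIV. p $ \<omega> * f \<omega>"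
  have "closed ?P"
    unfolding ambiguity_set_def less_eq_vec_def
    by (simp add: closed_Collect_conj closed_Collect_all closed_Collect_le
        continuous_on_component continuous_on_sum continuous_on_mult_right)
  moreover have "?P \<subseteq> cbox pl pu" by (auto simp: ambiguity_set_def mem_box_cart)
  ultimately have "compact ?P"
    using bounded_cbox bounded_subset compact_eq_bounded_closed by blast
  moreover have "continuous_on ?P ?f"
    by (intro continuous_on_sum continuous_on_mult_right continuous_on_component continuous_on_id)
  ultimately obtain p where p: "p \<in> ?P" "\<forall>r\<in>?P. ?f r \<le> ?f p"
    using continuous_attains_sup[OF _ assms, of ?f] by blast
  then have "(SUP p\<in>?P. ?f p) = ?f p" by (intro cSup_eq_maximum) auto
  with p show ?thesis by auto
qed

end

theory Submission
  imports Defs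
begin

text \<open>
  For a fixed first-stage decision \<open>x\<close> the inner maximization over \<open>p\<close> is a linear program,
  bounded above and feasible because the ambiguity set is nonempty and lies in the box between
  \<open>pl\<close> and \<open>pu\<close>. Its dual is the minimization of
  \<open>lam \<bullet> \<theta> x + (\<Sum>\<omega>. \<gamma> $ \<omega> * pu $ \<omega> - \<mu> $ \<omega> * pl $ \<omega>)\<close> under
  \<open>\<gamma> $ \<omega> - \<mu> $ \<omega> \<ge> h x \<omega> - lam \<bullet> g (\<xi> \<omega>)\<close>, where \<open>lam\<close>, \<open>\<gamma>\<close> and \<open>\<mu>\<close> price the moment
  constraints and the upper and lower probability bounds. Since \<open>h x \<omega>\<close> is a minimum, it may be
  replaced in this constraint by the cost of an arbitrary feasible recourse decision \<open>y \<omega>\<close>: such a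
  cost can only be larger than \<open>h x \<omega>\<close>, and an optimal decision gives equality. Hence

  \<^item> every feasible point of the reformulation has at least the worst-case cost of its \<open>x\<close>
    (weak duality, \<open>ambiguity_weak_duality\<close>), and

  \<^item> above every \<open>x\<close> there is a feasible point attaining that cost, made of optimal dual
    multipliers (\<open>ambiguity_dual_multipliers\<close>) and optimal recourse decisions.

  So the worst-case objective is the partial minimum, with attainment, of the objective of the
  reformulation, and minimizing in one or in two stages amounts to the same
  (\<open>optimal_value_partial_min\<close>, \<open>optimal_solution_partial_min\<close>).

  Attainment in the dual is needed for the statement on optimal solutions. It comes from the
  affine form of Farkas' lemma (\<open>affine_farkas\<close>), whose source is the closedness of finitely
  generated cones.
\<close>

section \<open>The affine Farkas lemma\<close>

text \<open>
  The conic combinations of the \<open>v i\<close> already form a convex cone, so the hull adds nothing.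
  Indexing by \<open>J\<close> instead of by the set of generators keeps one multiplier per constraint even if
  two constraints coincide.
\<close>

lemma convex_cone_hull_image_subset:
  fixes v :: "'i \<Rightarrow> 'a::real_vector"
  assumes "finite J"
  shows "convex_cone hull (v ` J) \<subseteq> {\<Sum>i\<in>J. u i *\<^sub>R v i |u. \<forall>i\<in>J. 0 \<le> u i}"
proof (rule hull_minimal)
  let ?K = "{\<Sum>i\<in>J. u i *\<^sub>R v i |u. \<forall>i\<in>J. 0 \<le> u i}"
  show "v ` J \<subseteq> ?K"
  proof clarify
    fix j assume j: "j \<in> J"
    let ?u = "\<lambda>i. if i = j then 1 else (0::real)"
    have "(\<Sum>i\<in>J. ?u i *\<^sub>R v i) = (\<Sum>i\<in>J. if i = j then v i else 0)"
      by (intro sum.cong) auto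
    also have "\<dots> = v j" using assms j by simp
    finally have "v j = (\<Sum>i\<in>J. ?u i *\<^sub>R v i)" ..
    moreover have "\<forall>i\<in>J. 0 \<le> ?u i" by simp
    ultimately have "v j = (\<Sum>i\<in>J. ?u i *\<^sub>R v i) \<and> (\<forall>i\<in>J. 0 \<le> ?u i)" ..
    then show "\<exists>u. v j = (\<Sum>i\<in>J. u i *\<^sub>R v i) \<and> (\<forall>i\<in>J. 0 \<le> u i)"
      by (rule exI[of _ ?u])
  qed
  show "convex_cone ?K"
    unfolding convex_cone_iff
  proof (intro conjI ballI allI impI)
    show "0 \<in> ?K" by (auto intro!: exI[of _ "\<lambda>_. 0"])
  next
    fix x y assume "x \<in> ?K" "y \<in> ?K"
    then obtain u w where "x = (\<Sum>i\<in>J. u i *\<^sub>R v i)" "y = (\<Sum>i\<in>J. w i *\<^sub>R v i)"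
      and "\<forall>i\<in>J. 0 \<le> u i" "\<forall>i\<in>J. 0 \<le> w i" by blast
    then show "x + y \<in> ?K"
      by (auto intro!: exI[of _ "\<lambda>i. u i + w i"] simp: scaleR_add_left sum.distrib)
  next
    fix x and r :: real assume "x \<in> ?K" "0 \<le> r"
    then obtain u where "x = (\<Sum>i\<in>J. u i *\<^sub>R v i)" "\<forall>i\<in>J. 0 \<le> u i" by blast
    with \<open>0 \<le> r\<close> show "r *\<^sub>R x \<in> ?K"
      by (auto intro!: exI[of _ "\<lambda>i. r * u i"] simp: scaleR_sum_right)
  qed
qed

text \<open>
  A hyperplane strictly separating a point from a cone can be moved to the origin: on a ray of the
  cone a negative value would be scaled below any bound.
\<close>

lemma separating_hyperplane_convex_cone:
  fixes K :: "'a::euclidean_space set"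
  assumes "convex_cone K" "closed K" "z \<notin> K"
  obtains a where "a \<bullet> z < 0" "\<And>x. x \<in> K \<Longrightarrow> 0 \<le> a \<bullet> x"
proof -
  have "convex K" using assms(1) by (simp add: convex_cone_def)
  then obtain a \<beta> where a: "a \<bullet> z < \<beta>" "\<forall>x\<in>K. \<beta> < a \<bullet> x"
    using separating_hyperplane_closed_point assms by blast
  have "0 \<in> K" using assms(1) by (rule convex_cone_contains_0)
  with a have "\<beta> < 0" by force
  have "0 \<le> a \<bullet> x" if "x \<in> K" for x
  proof (rule ccontr)
    assume neg: "\<not> 0 \<le> a \<bullet> x"
    with \<open>\<beta> < 0\<close> have "0 \<le> \<beta> / (a \<bullet> x)" by (simp add: divide_nonpos_neg)
    then have "(\<beta> / (a \<bullet> x)) *\<^sub>R x \<in> K" using assms(1) that by (simp add: convex_cone_scaleR)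
    with a have "\<beta> < a \<bullet> ((\<beta> / (a \<bullet> x)) *\<^sub>R x)" by blast
    then show False using neg by simp
  qed
  with a \<open>\<beta> < 0\<close> show thesis by (intro that[of a]) auto
qed

text \<open>
  The claim is that \<open>(f, V)\<close> lies in the cone generated by the rows \<open>(a i, b i)\<close> and by \<open>(0, 1)\<close>,
  the trivial inequality \<open>0 \<le> 1\<close>. Otherwise a hyperplane \<open>(z, t)\<close> with \<open>t \<ge> 0\<close> separates it from
  this cone. If \<open>t > 0\<close>, then \<open>- z / t\<close> is a feasible point of value above \<open>V\<close>; if \<open>t = 0\<close>, then
  \<open>- z\<close> is a direction of recession along which the value grows without bound.
\<close>

lemma affine_farkas:
  fixes a :: "'i \<Rightarrow> 'a::euclidean_space" and b :: "'i \<Rightarrow> real"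
  assumes "finite J"
    and feasible: "\<forall>i\<in>J. a i \<bullet> p\<^sub>0 \<le> b i"
    and bound: "\<And>p. \<forall>i\<in>J. a i \<bullet> p \<le> b i \<Longrightarrow> f \<bullet> p \<le> V"
  obtains u where "\<forall>i\<in>J. 0 \<le> u i" "f = (\<Sum>i\<in>J. u i *\<^sub>R a i)" "(\<Sum>i\<in>J. u i * b i) \<le> V"
proof -
  \<comment> \<open>The index \<open>None\<close> stands for the trivial inequality.\<close>
  define v where "v = case_option (0, 1) (\<lambda>i. (a i, b i))"
  let ?J = "insert None (Some ` J)"
  let ?K = "convex_cone hull (v ` ?J)"
  have fin: "finite ?J" using assms(1) by simp
  have "(f, V) \<in> ?K"
  proof (rule ccontr)
    assume "(f, V) \<notin> ?K"
    then obtain e where e: "e \<bullet> (f, V) < 0" "\<And>x. x \<in> ?K \<Longrightarrow> 0 \<le> e \<bullet> x"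
      using separating_hyperplane_convex_cone[of ?K "(f, V)"] fin
      by (metis closed_convex_cone_hull convex_cone_convex_cone_hull finite_imageI)
    obtain z t where zt: "e = (z, t)" by (cases e)
    have "v None \<in> ?K" by (simp add: hull_inc)
    from e(2)[OF this] have t: "0 \<le> t" by (simp add: v_def zt)
    have row: "0 \<le> z \<bullet> a i + t * b i" if "i \<in> J" for i
    proof -
      have "v (Some i) \<in> ?K" using that by (simp add: hull_inc)
      from e(2)[OF this] show ?thesis by (simp add: v_def zt)
    qed
    have neg: "z \<bullet> f + t * V < 0" using e(1) by (simp add: zt)
    show False
    proof (cases "t = 0")
      case True
      \<comment> \<open>The step length at which the ray from \<open>p\<^sub>0\<close> reaches the value \<open>V + 1\<close>.\<close>
      define r where "r = (V + 1 - f \<bullet> p\<^sub>0) / (- (z \<bullet> f))"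
      have zf: "z \<bullet> f < 0" using neg True by simp
      have "f \<bullet> p\<^sub>0 \<le> V" using bound feasible by blast
      with zf have r: "0 \<le> r" unfolding r_def by (intro divide_nonneg_pos) auto
      have "\<forall>i\<in>J. a i \<bullet> (p\<^sub>0 - r *\<^sub>R z) \<le> b i"
      proof
        fix i assume "i \<in> J"
        then have "0 \<le> r * (z \<bullet> a i)" using row True r by simp
        moreover have "a i \<bullet> p\<^sub>0 \<le> b i" using feasible \<open>i \<in> J\<close> by blast
        ultimately show "a i \<bullet> (p\<^sub>0 - r *\<^sub>R z) \<le> b i"
          by (simp add: inner_diff_right inner_commute)
      qed
      from bound[OF this] have "f \<bullet> p\<^sub>0 - r * (z \<bullet> f) \<le> V"
        by (simp add: inner_diff_right inner_commute)
      moreover have "r * (z \<bullet> f) = - (V + 1 - f \<bullet> p\<^sub>0)"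
        using zf by (simp add: r_def)
      ultimately show False by simp
    next
      case False
      with t have t: "0 < t" by simp
      have "\<forall>i\<in>J. a i \<bullet> ((- 1 / t) *\<^sub>R z) \<le> b i"
      proof
        fix i assume "i \<in> J"
        from row[OF this] have "- (z \<bullet> a i) \<le> b i * t" by (simp add: mult.commute)
        then show "a i \<bullet> ((- 1 / t) *\<^sub>R z) \<le> b i"
          using t by (simp add: pos_divide_le_eq inner_commute[of z] flip: divide_minus_left)
      qed
      from bound[OF this] show False
        using neg t by (simp add: field_simps inner_commute)
    qed
  qed
  then obtain u where u: "\<forall>i\<in>?J. 0 \<le> u i" "(f, V) = (\<Sum>i\<in>?J. u i *\<^sub>R v i)"
    using convex_cone_hull_image_subset[OF fin, of v] by blast
  have "(\<Sum>i\<in>?J. u i *\<^sub>R v i) = (0, u None) + (\<Sum>i\<in>J. u (Some i) *\<^sub>R (a i, b i))"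
    using assms(1) by (simp add: v_def sum.reindex)
  also have "\<dots> = (\<Sum>i\<in>J. u (Some i) *\<^sub>R a i, u None + (\<Sum>i\<in>J. u (Some i) * b i))"
    by (simp add: prod_eq_iff fst_sum snd_sum)
  finally have "f = (\<Sum>i\<in>J. u (Some i) *\<^sub>R a i)" "V = u None + (\<Sum>i\<in>J. u (Some i) * b i)"
    using u(2) by auto
  with u(1) show thesis by (intro that[of "\<lambda>i. u (Some i)"]) auto
qed

section \<open>Duality over the ambiguity set\<close>

lemma sum_inner_swap:
  fixes lam :: "real^'s::finite" and G :: "'w::finite \<Rightarrow> real^'s" and p :: "real^'w"
  shows "(\<Sum>\<omega>\<in>UNIV. p $ \<omega> * (lam \<bullet> G \<omega>)) = (\<Sum>i\<in>UNIV. lam $ i * (\<Sum>\<omega>\<in>UNIV. p $ \<omega> * G \<omega> $ i))"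
  unfolding inner_vec_def inner_real_def sum_distrib_left
  by (subst sum.swap) (simp add: mult.left_commute)

lemma ambiguity_weak_duality:
  assumes p: "p \<in> ambiguity_set pl pu g \<xi> \<theta> x"
    and "lam \<ge> 0" "\<gamma> \<ge> 0" "\<mu> \<ge> 0"
    and dual: "\<And>\<omega>. f \<omega> - lam \<bullet> g (\<xi> \<omega>) \<le> \<gamma> $ \<omega> - \<mu> $ \<omega>"
  shows "(\<Sum>\<omega>\<in>UNIV. p $ \<omega> * f \<omega>)
           \<le> lam \<bullet> \<theta> x + (\<Sum>\<omega>\<in>UNIV. \<gamma> $ \<omega> * pu $ \<omega> - \<mu> $ \<omega> * pl $ \<omega>)"
proof -
  have nonneg: "\<And>i. 0 \<le> lam $ i" "\<And>\<omega>. 0 \<le> \<gamma> $ \<omega>" "\<And>\<omega>. 0 \<le> \<mu> $ \<omega>" "\<And>\<omega>. 0 \<le> p $ \<omega>"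
    using assms by (auto simp: less_eq_vec_def ambiguity_set_def)
  have bounds: "pl $ \<omega> \<le> p $ \<omega>" "p $ \<omega> \<le> pu $ \<omega>" for \<omega>
    using p by (auto simp: ambiguity_set_def)
  have moments: "(\<Sum>\<omega>\<in>UNIV. p $ \<omega> * g (\<xi> \<omega>) $ i) \<le> \<theta> x $ i" for i
    using p by (auto simp: ambiguity_set_def)
  have "(\<Sum>\<omega>\<in>UNIV. p $ \<omega> * f \<omega>)
      \<le> (\<Sum>\<omega>\<in>UNIV. p $ \<omega> * (lam \<bullet> g (\<xi> \<omega>)) + (\<gamma> $ \<omega> * pu $ \<omega> - \<mu> $ \<omega> * pl $ \<omega>))"
  proof (rule sum_mono)
    fix \<omega>
    have "p $ \<omega> * f \<omega> \<le> p $ \<omega> * (lam \<bullet> g (\<xi> \<omega>) + (\<gamma> $ \<omega> - \<mu> $ \<omega>))"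
      using dual[of \<omega>] nonneg(4) by (intro mult_left_mono) auto
    moreover have "\<gamma> $ \<omega> * p $ \<omega> \<le> \<gamma> $ \<omega> * pu $ \<omega>" "\<mu> $ \<omega> * pl $ \<omega> \<le> \<mu> $ \<omega> * p $ \<omega>"
      using bounds nonneg by (auto intro: mult_left_mono)
    ultimately show "p $ \<omega> * f \<omega>
        \<le> p $ \<omega> * (lam \<bullet> g (\<xi> \<omega>)) + (\<gamma> $ \<omega> * pu $ \<omega> - \<mu> $ \<omega> * pl $ \<omega>)"
      by (simp add: algebra_simps)
  qed
  also have "\<dots> = (\<Sum>i\<in>UNIV. lam $ i * (\<Sum>\<omega>\<in>UNIV. p $ \<omega> * g (\<xi> \<omega>) $ i))
      + (\<Sum>\<omega>\<in>UNIV. \<gamma> $ \<omega> * pu $ \<omega> - \<mu> $ \<omega> * pl $ \<omega>)"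
    by (simp only: sum.distrib sum_inner_swap)
  also have "(\<Sum>i\<in>UNIV. lam $ i * (\<Sum>\<omega>\<in>UNIV. p $ \<omega> * g (\<xi> \<omega>) $ i)) \<le> lam \<bullet> \<theta> x"
    unfolding inner_vec_def inner_real_def using moments nonneg
    by (intro sum_mono mult_left_mono) auto
  finally show ?thesis by simp
qed

text \<open>
  The multipliers come from the Farkas lemma applied to the three families of constraints: moments,
  upper bounds and lower bounds. When \<open>pl \<ge> 0\<close> these three describe the ambiguity set completely,
  with \<open>p\<close> of free sign in the linear program; this is why the dual constraint holds with equality.
\<close>

lemma ambiguity_dual_multipliers:
  fixes pl pu :: "real^'w::finite" and \<theta> :: "'x \<Rightarrow> real^'s::finite"
  assumes "\<And>\<omega>. 0 \<le> pl $ \<omega>"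
    and p\<^sub>0: "p\<^sub>0 \<in> ambiguity_set pl pu g \<xi> \<theta> x"
    and bound: "\<And>p. p \<in> ambiguity_set pl pu g \<xi> \<theta> x \<Longrightarrow> (\<Sum>\<omega>\<in>UNIV. p $ \<omega> * f \<omega>) \<le> V"
  obtains lam \<gamma> \<mu> where "lam \<ge> 0" "\<gamma> \<ge> 0" "\<mu> \<ge> 0"
    and "\<And>\<omega>. \<gamma> $ \<omega> - \<mu> $ \<omega> = f \<omega> - lam \<bullet> g (\<xi> \<omega>)"
    and "lam \<bullet> \<theta> x + (\<Sum>\<omega>\<in>UNIV. \<gamma> $ \<omega> * pu $ \<omega> - \<mu> $ \<omega> * pl $ \<omega>) \<le> V"
proof -
  define a :: "'s + 'w + 'w \<Rightarrow> real^'w" where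
    "a = case_sum (\<lambda>i. \<chi> \<omega>. g (\<xi> \<omega>) $ i) (case_sum (\<lambda>\<omega>. axis \<omega> 1) (\<lambda>\<omega>. - axis \<omega> 1))"
  define b :: "'s + 'w + 'w \<Rightarrow> real" where
    "b = case_sum (\<lambda>i. \<theta> x $ i) (case_sum (\<lambda>\<omega>. pu $ \<omega>) (\<lambda>\<omega>. - pl $ \<omega>))"
  have moment: "(\<chi> \<omega>. g (\<xi> \<omega>) $ i) \<bullet> p = (\<Sum>\<omega>\<in>UNIV. p $ \<omega> * g (\<xi> \<omega>) $ i)" for i p
    by (simp add: inner_vec_def mult.commute)
  have system: "p \<in> ambiguity_set pl pu g \<xi> \<theta> x \<longleftrightarrow> (\<forall>j\<in>UNIV. a j \<bullet> p \<le> b j)" for p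
  proof -
    have "0 \<le> p $ \<omega>" if "\<forall>\<omega>. pl $ \<omega> \<le> p $ \<omega>" for \<omega>
      using assms(1)[of \<omega>] that[rule_format, of \<omega>] by linarith
    then have nonneg: "(\<forall>\<omega>. pl $ \<omega> \<le> p $ \<omega>) \<Longrightarrow> p \<ge> 0" by (simp add: less_eq_vec_def)
    show ?thesis
      by (auto simp: ambiguity_set_def a_def b_def inner_axis' moment split_sum_all
          intro: nonneg)
  qed
  have objective: "(\<chi> \<omega>. f \<omega>) \<bullet> p = (\<Sum>\<omega>\<in>UNIV. p $ \<omega> * f \<omega>)" for p
    by (simp add: inner_vec_def mult.commute)
  obtain u where u: "\<forall>j\<in>UNIV. 0 \<le> u j" "(\<chi> \<omega>. f \<omega>) = (\<Sum>j\<in>UNIV. u j *\<^sub>R a j)"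
      "(\<Sum>j\<in>UNIV. u j * b j) \<le> V"
  proof (rule affine_farkas)
    show "\<forall>j\<in>UNIV. a j \<bullet> p\<^sub>0 \<le> b j" using p\<^sub>0 system by blast
    show "(\<chi> \<omega>. f \<omega>) \<bullet> p \<le> V" if "\<forall>j\<in>UNIV. a j \<bullet> p \<le> b j" for p
      using bound that system objective by simp
  qed auto
  define lam :: "real^'s" where "lam = (\<chi> i. u (Inl i))"
  define \<gamma> :: "real^'w" where "\<gamma> = (\<chi> \<omega>. u (Inr (Inl \<omega>)))"
  define \<mu> :: "real^'w" where "\<mu> = (\<chi> \<omega>. u (Inr (Inr \<omega>)))"
  have split: "(\<Sum>j\<in>UNIV. F j) = (\<Sum>i\<in>UNIV. F (Inl i)) + ((\<Sum>\<omega>\<in>UNIV. F (Inr (Inl \<omega>)))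
      + (\<Sum>\<omega>\<in>UNIV. F (Inr (Inr \<omega>))))"
    for F :: "'s + 'w + 'w \<Rightarrow> 'b::comm_monoid_add"
    unfolding UNIV_Plus_UNIV[symmetric] by (simp add: sum.Plus del: UNIV_Plus_UNIV)
  have "f \<omega> = lam \<bullet> g (\<xi> \<omega>) + (\<gamma> $ \<omega> - \<mu> $ \<omega>)" for \<omega>
  proof -
    have pick: "(\<Sum>\<omega>'\<in>UNIV. F \<omega>' * axis \<omega>' 1 $ \<omega>) = F \<omega>" for F :: "'w \<Rightarrow> real"
      by (simp add: axis_def if_distrib cong: if_cong)
    have "f \<omega> = (\<chi> \<omega>. f \<omega>) $ \<omega>" by simp
    also have "\<dots> = lam \<bullet> g (\<xi> \<omega>) + (\<gamma> $ \<omega> - \<mu> $ \<omega>)"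
      unfolding u(2) split
      by (simp add: a_def lam_def \<gamma>_def \<mu>_def inner_vec_def sum_negf pick)
    finally show ?thesis .
  qed
  moreover have "lam \<bullet> \<theta> x + (\<Sum>\<omega>\<in>UNIV. \<gamma> $ \<omega> * pu $ \<omega> - \<mu> $ \<omega> * pl $ \<omega>) \<le> V"
    using u(3) unfolding split
    by (simp add: b_def lam_def \<gamma>_def \<mu>_def inner_vec_def sum_negf sum_subtractf)
  moreover have "lam \<ge> 0" "\<gamma> \<ge> 0" "\<mu> \<ge> 0"
    using u(1) by (auto simp: less_eq_vec_def lam_def \<gamma>_def \<mu>_def)
  ultimately show thesis by (intro that[of lam \<gamma> \<mu>]) auto
qed

section \<open>Partial minimization\<close>

text \<open>
  Here \<open>\<pi>\<close> projects \<open>S\<close> onto \<open>X\<close>, and \<open>f\<close> is the attained minimum of \<open>F\<close> over each fibre. Only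
  the fibrewise minima have to exist: as \<open>\<theta>\<close> is an arbitrary function of \<open>x\<close>, the worst-case objective
  can be discontinuous, and its infimum over the compact set \<open>X\<close> need not be attained.
\<close>

lemma optimal_value_partial_min:
  assumes lower: "\<And>z. z \<in> S \<Longrightarrow> \<pi> z \<in> X \<and> f (\<pi> z) \<le> F z"
    and attained: "\<And>x. x \<in> X \<Longrightarrow> \<exists>z\<in>S. \<pi> z = x \<and> F z = f x"
  shows "optimal_value f X = optimal_value F S"
  unfolding optimal_value_def
proof (rule antisym)
  show "(INF x\<in>X. ereal (f x)) \<le> (INF z\<in>S. ereal (F z))"
    using lower by (intro INF_mono) force
  show "(INF z\<in>S. ereal (F z)) \<le> (INF x\<in>X. ereal (f x))"
    using attained by (intro INF_mono) force
qed

lemma optimal_solution_partial_min: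
  assumes lower: "\<And>z. z \<in> S \<Longrightarrow> \<pi> z \<in> X \<and> f (\<pi> z) \<le> F z"
    and attained: "\<And>x. x \<in> X \<Longrightarrow> \<exists>z\<in>S. \<pi> z = x \<and> F z = f x"
  shows "optimal_solution f X x \<longleftrightarrow> (\<exists>z. \<pi> z = x \<and> optimal_solution F S z)"
  unfolding is_arg_min_linorder
proof
  assume opt: "x \<in> X \<and> (\<forall>x'. x' \<in> X \<longrightarrow> f x \<le> f x')"
  then obtain z where "z \<in> S" "\<pi> z = x" "F z = f x" using attained by blast
  moreover have "\<forall>z'. z' \<in> S \<longrightarrow> f x \<le> F z'" using opt lower order_trans by blast
  ultimately show "\<exists>z. \<pi> z = x \<and> z \<in> S \<and> (\<forall>z'. z' \<in> S \<longrightarrow> F z \<le> F z')" by auto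
next
  assume "\<exists>z. \<pi> z = x \<and> z \<in> S \<and> (\<forall>z'. z' \<in> S \<longrightarrow> F z \<le> F z')"
  then obtain z where z: "\<pi> z = x" "z \<in> S" "\<And>z'. z' \<in> S \<Longrightarrow> F z \<le> F z'" by blast
  have "f x \<le> f x'" if "x' \<in> X" for x'
    using attained[OF that] lower[OF z(2)] z by force
  then show "x \<in> X \<and> (\<forall>x'. x' \<in> X \<longrightarrow> f x \<le> f x')" using lower z by blast
qed

section \<open>The reformulation\<close>

theorem corollary2:
  fixes I :: "'n::finite set" and A :: "real^'n^'k::finite" and d :: "real^'k"
    and c :: "real^'n" and C :: "real^'n^'n"
    and q :: "'w::finite \<Rightarrow> real^'m::finite" and L :: "'w \<Rightarrow> real^'m^'n"
    and D :: "'w \<Rightarrow> real^'m^'l::finite" and B :: "'w \<Rightarrow> real^'n^'l" and b :: "'w \<Rightarrow> real^'l"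
    and \<xi> :: "'w \<Rightarrow> real^'r::finite" and g :: "real^'r \<Rightarrow> real^'s::finite"
    and \<theta> :: "real^'n \<Rightarrow> real^'s" and pl pu :: "real^'w" and i1 i2 :: 's
    and X :: "(real^'n) set" and P :: "real^'n \<Rightarrow> (real^'w) set"
    and Y :: "real^'n \<Rightarrow> 'w \<Rightarrow> (real^'m) set"
    and \<psi>\<^sub>0 :: "real^'n \<Rightarrow> real^'m \<Rightarrow> 'w \<Rightarrow> real" and h :: "real^'n \<Rightarrow> 'w \<Rightarrow> real"
  assumes X_def: "X = first_stage_set I A d"
    and \<psi>\<^sub>0_def: "\<psi>\<^sub>0 = recourse_cost q L"
    and Y_def: "Y = recourse_set D B b"
    and h_def: "h = recourse_value \<psi>\<^sub>0 Y"
    and P_def: "P = ambiguity_set pl pu g \<xi> \<theta>"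
    and X_nonempty: "X \<noteq> {}"
    and X_compact: "compact X"
    and p_bounds: "\<And>\<omega>. 0 \<le> pl $ \<omega> \<and> pl $ \<omega> \<le> pu $ \<omega>"
    and g1: "\<And>\<omega>. g (\<xi> \<omega>) $ i1 = 1" and \<theta>1: "\<And>x. x \<in> X \<Longrightarrow> \<theta> x $ i1 = 1"
    and g2: "\<And>\<omega>. g (\<xi> \<omega>) $ i2 = -1" and \<theta>2: "\<And>x. x \<in> X \<Longrightarrow> \<theta> x $ i2 = -1"
    and P_nonempty: "\<And>x. x \<in> X \<Longrightarrow> P x \<noteq> {}"
    and complete_recourse: "\<And>x \<omega>. Y x \<omega> \<noteq> {}"
    and Y_bounded: "\<And>x \<omega>. bounded (Y x \<omega>)"
  shows "optimal_value (dro_objective c C h P) X =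
           optimal_value (minlp_objective c C \<theta> pl pu) (minlp_feasible X Y \<psi>\<^sub>0 g \<xi>) \<and>
         (\<forall>x\<in>X. optimal_solution (dro_objective c C h P) X x \<longleftrightarrow>
            (\<exists>lam y \<gamma> \<mu>. optimal_solution (minlp_objective c C \<theta> pl pu)
                           (minlp_feasible X Y \<psi>\<^sub>0 g \<xi>) (x, lam, y, \<gamma>, \<mu>)))"
proof -
  let ?F = "minlp_objective c C \<theta> pl pu" and ?S = "minlp_feasible X Y \<psi>\<^sub>0 g \<xi>"
  let ?f = "dro_objective c C h P"
  have recourse: "\<exists>y\<in>Y x \<omega>. h x \<omega> = \<psi>\<^sub>0 x y \<omega> \<and> (\<forall>z\<in>Y x \<omega>. \<psi>\<^sub>0 x y \<omega> \<le> \<psi>\<^sub>0 x z \<omega>)" for x \<omega>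
    using complete_recourse[of x \<omega>] Y_bounded[of x \<omega>]
    unfolding h_def Y_def \<psi>\<^sub>0_def by (rule recourse_value_attained)
  have worst: "\<exists>p\<in>P x. ?f x = c \<bullet> x + x \<bullet> (C *v x) + (\<Sum>\<omega>\<in>UNIV. p $ \<omega> * h x \<omega>) \<and>
      (\<forall>r\<in>P x. (\<Sum>\<omega>\<in>UNIV. r $ \<omega> * h x \<omega>) \<le> (\<Sum>\<omega>\<in>UNIV. p $ \<omega> * h x \<omega>))" if "x \<in> X" for x
    using worst_case_attained[OF P_nonempty[OF that, unfolded P_def], of "h x"]
    unfolding dro_objective_def P_def by simp
  have lower: "fst z \<in> X \<and> ?f (fst z) \<le> ?F z" if "z \<in> ?S" for z
  proof -
    obtain x lam y \<gamma> \<mu> where z: "z = (x, lam, y, \<gamma>, \<mu>)" by (cases z)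
    have x: "x \<in> X" and signs: "lam \<ge> 0" "\<gamma> \<ge> 0" "\<mu> \<ge> 0"
      and dual: "\<psi>\<^sub>0 x (y \<omega>) \<omega> - lam \<bullet> g (\<xi> \<omega>) \<le> \<gamma> $ \<omega> - \<mu> $ \<omega>"
      and y: "y \<omega> \<in> Y x \<omega>" for \<omega>
      using that by (auto simp: z minlp_feasible_def)
    obtain p where p: "p \<in> P x" "?f x = c \<bullet> x + x \<bullet> (C *v x) + (\<Sum>\<omega>\<in>UNIV. p $ \<omega> * h x \<omega>)"
      using worst[OF x] by blast
    have "h x \<omega> - lam \<bullet> g (\<xi> \<omega>) \<le> \<gamma> $ \<omega> - \<mu> $ \<omega>" for \<omega>
      using recourse[of x \<omega>] y[of \<omega>] dual[of \<omega>] by force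
    with ambiguity_weak_duality[OF p(1)[unfolded P_def] signs, of "h x"] x p(2) show ?thesis
      by (simp add: z)
  qed
  have attained: "\<exists>z\<in>?S. fst z = x \<and> ?F z = ?f x" if x: "x \<in> X" for x
  proof -
    obtain p where p: "p \<in> P x" "?f x = c \<bullet> x + x \<bullet> (C *v x) + (\<Sum>\<omega>\<in>UNIV. p $ \<omega> * h x \<omega>)"
        "\<forall>r\<in>P x. (\<Sum>\<omega>\<in>UNIV. r $ \<omega> * h x \<omega>) \<le> (\<Sum>\<omega>\<in>UNIV. p $ \<omega> * h x \<omega>)"
      using worst[OF x] by blast
    obtain lam \<gamma> \<mu> where signs: "lam \<ge> 0" "\<gamma> \<ge> 0" "\<mu> \<ge> 0"
      and dual: "\<And>\<omega>. \<gamma> $ \<omega> - \<mu> $ \<omega> = h x \<omega> - lam \<bullet> g (\<xi> \<omega>)"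
      and val: "lam \<bullet> \<theta> x + (\<Sum>\<omega>\<in>UNIV. \<gamma> $ \<omega> * pu $ \<omega> - \<mu> $ \<omega> * pl $ \<omega>)
          \<le> (\<Sum>\<omega>\<in>UNIV. p $ \<omega> * h x \<omega>)"
      using ambiguity_dual_multipliers[of pl p pu g \<xi> \<theta> x "h x"] p p_bounds
      unfolding P_def by blast
    obtain y where y: "\<And>\<omega>. y \<omega> \<in> Y x \<omega>" "\<And>\<omega>. h x \<omega> = \<psi>\<^sub>0 x (y \<omega>) \<omega>"
      using recourse[of x] by metis
    let ?z = "(x, lam, y, \<gamma>, \<mu>)"
    have z: "?z \<in> ?S" using x signs dual y by (simp add: minlp_feasible_def)
    moreover have "?F ?z \<le> ?f x" using val p(2) by simp
    ultimately have "?F ?z = ?f x" using lower[OF z] by simp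
    with z show ?thesis by force
  qed
  have "optimal_value ?f X = optimal_value ?F ?S"
    using lower attained by (rule optimal_value_partial_min)
  moreover have "optimal_solution ?f X x \<longleftrightarrow>
      (\<exists>lam y \<gamma> \<mu>. optimal_solution ?F ?S (x, lam, y, \<gamma>, \<mu>))" for x
    using optimal_solution_partial_min[OF lower attained, of x] by auto
  ultimately show ?thesis by blast
qed

end
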